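(* Suppose $F(x)=\sum_{n>0} f(n)x^n$ is a generating function, where $f(1)\neq 0$, $F^{\Delta}(n,k)$ is the composita of $F(x)$, and $A(x)=\sum_{n>0}a(n)x^n$ is the generating function which is obtained from the functional equation $A(A(x))=F(x)$. Then for the composita $A^{\Delta}(n,k)$ of the generating function $A(x)$ we have the following recurrent formula: $$ A^{\Delta}(n,k)=\begin{cases} f(1)^{\frac{n}{2}}, & n=k;\\[4pt] \dfrac{1}{f(1)^{\frac{n}{2}}+f(1)^{\frac{k}{2}}}\left(F^{\Delta}(n,k)-\sum\limits_{m=k+1}^{n-1} A^{\Delta}(n,m)A^{\Delta}(m,k)\right), & n>k. \end{cases} $$
   Context: For an ordinary generating function $G(x)=\sum_{n>0}g(n)x^n$ (zero constant term), its composita is the function of two variables $$G^{\Delta}(n,k)=\sum_{\lambda_1+\cdots+\lambda_k=n,\ \lambda_i\ge 1} g(\lambda_1)g(\lambda_2)\cdots g(\lambda_k),$$ the sum being over all compositions of the integer $n$ into exactly $k$ positive parts; equivalently, $[G(x)]^k=\sum_{n\ge k}G^{\Delta}(n,k)x^n$, so $G^{\Delta}(n,k)$ is the coefficient of $x^n$ in $G(x)^k$. $A(A(x))$ denotes the composition of $A$ with itself. An empty sum is $0$.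
   Formalization: Here f(1)^{1/2} means the square root of f(1) equal to a(1) (for A=-x, F=x the root 1 would give a false formula), and for n>k the formula is asserted only when the denominator f(1)^{n/2}+f(1)^{k/2} is nonzero. *)

theory Defs
  imports "HOL-Computational_Algebra.Formal_Power_Series"
begin

unbundle fps_syntax

definition compositions :: "nat \<Rightarrow> nat \<Rightarrow> nat list set" where
  "compositions n k = {ps. length ps = k \<and> (\<forall>p\<in>set ps. 1 \<le> p) \<and> sum_list ps = n}"

definition composita :: "'a::comm_semiring_1 fps \<Rightarrow> nat \<Rightarrow> nat \<Rightarrow> 'a" where
  "composita G n k = (\<Sum>ps\<in>compositions n k. \<Prod>p\<leftarrow>ps. G $ p)"

text \<open>The sum in the definition of the composita is never the default value of a
  sum over an infinite set.\<close>

lemma finite_compositions: "finite (compositions n k)"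
proof (rule finite_subset)
  show "compositions n k \<subseteq> {ps. set ps \<subseteq> {..n} \<and> length ps = k}"
    by (auto simp: compositions_def intro: member_le_sum_list)
  show "finite {ps. set ps \<subseteq> {..n} \<and> length ps = k}"
    by (rule finite_lists_length_eq) simp
qed

text \<open>
  A half-integer power \<open>c\<^bsup>n/2\<^esup>\<close> of a field element \<open>c\<close> only makes sense once a square
  root \<open>s\<close> of \<open>c\<close> has been chosen; it is then \<open>s ^ n\<close>. If \<open>A(A(x)) = F(x)\<close> then
  \<open>a(1)\<^sup>2 = f(1)\<close>, and the root \<open>f(1)\<^bsup>1/2\<^esup>\<close> belonging to the solution \<open>A\<close> is \<open>a(1)\<close>.
  The denominator \<open>s ^ n + s ^ k\<close> can vanish, for instance if \<open>s = -1\<close> and \<open>n - k\<close> is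
  odd. It cannot vanish for the positive square root of a positive real number:
\<close>

lemma positive_root_denominator_nonzero:
  fixes s :: "'a::linordered_field"
  assumes "s > 0"
  shows "s ^ n + s ^ k \<noteq> 0"
  using assms by (metis add_pos_pos less_irrefl zero_less_power)

end

theory Submission
  imports Defs
begin

text \<open>Expanding \<open>G ^ k\<close> gives a sum over \<open>natpermute n k\<close>, where
  parts may be 0. Since \<open>G $ 0 = 0\<close>, every list with a part 0 contributes a zero
  product, so only the compositions remain.\<close>

lemma composita_eq_power_nth:
  fixes G :: "'a::comm_ring_1 fps"
  assumes "G $ 0 = 0"
  shows "composita G n k = (G ^ k) $ n"
proof (cases k)
  case 0
  have "compositions n 0 = (if n = 0 then {[]} else {})"
    by (auto simp: compositions_def)
  with 0 show ?thesis
    by (simp add: composita_def)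
next
  \<comment> \<open>The product in \<open>fps_power_nth\<close> runs over \<open>{0..k - 1}\<close>,
    which lists the positions of \<open>ps\<close> only for positive \<open>k\<close>.\<close>
  case (Suc l)
  have zero: "(\<Prod>p\<leftarrow>ps. G $ p) = 0" if "ps \<in> natpermute n k - compositions n k" for ps
  proof -
    from that have "0 \<in> set ps"
      by (auto simp: natpermute_def compositions_def not_less_eq_eq)
    then have "0 \<in> set (map (($) G) ps)"
      using assms by force
    then show ?thesis
      by (induction ps) auto
  qed
  have "(G ^ k) $ n = (\<Sum>ps\<in>natpermute n k. \<Prod>j\<in>{0..l}. G $ (ps ! j))"
    using Suc by (simp add: fps_power_nth del: power_Suc)
  also have "\<dots> = (\<Sum>ps\<in>natpermute n k. \<Prod>p\<leftarrow>ps. G $ p)"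
    using Suc by (intro sum.cong refl)
      (simp add: natpermute_def prod.list_conv_set_nth atLeastLessThanSuc_atLeastAtMost)
  also have "\<dots> = (\<Sum>ps\<in>compositions n k. \<Prod>p\<leftarrow>ps. G $ p)"
    using zero by (intro sum.mono_neutral_right natpermute_finite)
      (auto simp: natpermute_def compositions_def)
  finally show ?thesis
    by (simp add: composita_def)
qed

lemma composita_eq_0:
  fixes G :: "'a::comm_ring_1 fps"
  assumes "G $ 0 = 0" and "n < k"
  shows "composita G n k = 0"
  using assms startsby_zero_power_prefix[of G k] by (simp add: composita_eq_power_nth)

lemma composita_same:
  fixes G :: "'a::idom fps"
  assumes "G $ 0 = 0"
  shows "composita G n n = (G $ 1) ^ n"
  using assms startsby_zero_power_nth_same[of G n] by (simp add: composita_eq_power_nth)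

text \<open>Substituting \<open>H\<close> is multiplicative, so the \<open>k\<close>-th power of
  \<open>G oo H\<close> is \<open>G ^ k oo H\<close>, that is, the powers \<open>H ^ m\<close>
  weighted by the coefficients of \<open>G ^ k\<close>. Those with \<open>m < k\<close>
  vanish.\<close>

lemma composita_compose:
  fixes G H :: "'a::idom fps"
  assumes "G $ 0 = 0" and "H $ 0 = 0"
  shows "composita (G oo H) n k = (\<Sum>m = k..n. composita H n m * composita G m k)"
proof -
  have "composita (G oo H) n k = (G ^ k oo H) $ n"
    using assms by (simp add: composita_eq_power_nth fps_compose_power)
  also have "\<dots> = (\<Sum>m = 0..n. composita H n m * composita G m k)"
    using assms by (simp add: fps_compose_nth composita_eq_power_nth mult.commute)
  also have "\<dots> = (\<Sum>m = k..n. composita H n m * composita G m k)"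
    using assms by (intro sum.mono_neutral_right) (auto simp: composita_eq_0)
  finally show ?thesis .
qed

text \<open>
  Taking compositae turns composition of power series into multiplication of triangular
  matrices. In the entry \<open>(n, k)\<close> of the square of the matrix of \<open>A\<close>, the unknown
  \<open>composita A n k\<close> occurs only in the summands \<open>m = k\<close> and \<open>m = n\<close>, multiplied by the
  diagonal entries \<open>s ^ k\<close> and \<open>s ^ n\<close>.
\<close>

theorem theorem3:
  fixes F A :: "'a::field fps" and s :: 'a and n k :: nat
  assumes "F $ 0 = 0" and "F $ 1 \<noteq> 0"
    and "A $ 0 = 0" and "A oo A = F"
    and "s ^ 2 = F $ 1" and "A $ 1 = s"
    and "1 \<le> k" and "k \<le> n"
    and "n > k \<Longrightarrow> s ^ n + s ^ k \<noteq> 0"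
  shows "composita A n k =
    (if n = k then s ^ n
     else 1 / (s ^ n + s ^ k) *
       (composita F n k - (\<Sum>m = k + 1..n - 1. composita A n m * composita A m k)))"
proof (cases "n = k")
  case True
  then show ?thesis
    using assms(3,6) composita_same[of A n] by simp
next
  case False
  with \<open>k \<le> n\<close> have "k < n" by simp
  then have nz: "s ^ n + s ^ k \<noteq> 0"
    by (rule assms(9))
  have diag: "composita A m m = s ^ m" for m
    using assms(3,6) composita_same[of A m] by simp
  let ?S = "\<Sum>m = k + 1..n - 1. composita A n m * composita A m k"
  \<comment> \<open>As \<open>k < n\<close>, the two ends are distinct and lie outside the middle
    range, which is empty for \<open>n = k + 1\<close>.\<close>
  have "{k..n} = insert k (insert n {k + 1..n - 1})"
    using \<open>k < n\<close> by auto
  then have "(\<Sum>m = k..n. composita A n m * composita A m k)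
      = composita A n k * s ^ k + (s ^ n * composita A n k + ?S)"
    using \<open>k < n\<close> by (simp add: diag)
  then have "composita F n k - ?S = (s ^ n + s ^ k) * composita A n k"
    using assms(3,4) composita_compose[of A A n k] by (simp add: algebra_simps)
  with False nz show ?thesis
    by simp
qed

end
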